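(* Let $n\ge k\ge 1$ and $0\le p\le 1/2$. Let $X$ be uniform on $\mathbb F_2^n$ and $Y=X\oplus Z$, where $Z$ is independent of $X$ and has i.i.d. Bernoulli$(p)$ coordinates. If $f:\mathbb F_2^n\to\mathbb F_2^k$ is the affine map $f(x)=Ax+b$, with $A\in\mathbb F_2^{k\times n}$ of rank $r\le k$ and $b\in\mathbb F_2^k$, then $$I(f(X);Y)\le r\,C(p)\le k\,C(p),$$ where $C(p)=1-h_2(p)$.
   Context: Entropies and mutual informations are measured in bits (logarithms base 2). $h_2(p)=-p\log_2 p-(1-p)\log_2(1-p)$ is the binary entropy function, with $0\log_2 0=0$. $\oplus$ is coordinatewise addition in $\mathbb F_2$. *)

theory Defs
  imports "HOL-Probability.Probability" "HOL-Library.Z2"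
begin

text \<open>The field with two elements is \<^typ>\<open>bit\<close>; its library theory provides no finiteness instance.\<close>

instance bit :: finite
proof
  have "(UNIV :: bit set) = {0, 1}"
    by (auto intro: bit.exhaust)
  then show "finite (UNIV :: bit set)"
    by (metis finite.emptyI finite.insertI)
qed

text \<open>The convention for \<open>p = 0\<close> and \<open>p = 1\<close> holds because the logarithm is total
  and is multiplied by zero there.\<close>

definition binary_entropy :: "real \<Rightarrow> real" where
  "binary_entropy p = - p * log 2 p - (1 - p) * log 2 (1 - p)"

definition bsc_capacity :: "real \<Rightarrow> real" where
  "bsc_capacity p = 1 - binary_entropy p"

end

theory Submission
  imports Defs
begin

text \<open>
  Write \<open>N = 2 ^ n\<close>, \<open>\<mu>\<close> for the law of \<open>Z\<close>, and \<open>Q v = P (A Z = v)\<close>.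
  Since \<open>f (X + Z) - f X = A Z\<close> and \<open>Y\<close> is uniform, the mutual information is
  \<open>(\<Sum>z. \<mu> z * log 2 (Q (A z))) - (\<Sum>x. 1 / N * log 2 (P (f X = f x)))\<close>, that is \<open>H(f X) - H(A Z)\<close>.
  The first entropy is at most \<open>r\<close> because \<open>f\<close> takes at most \<open>2 ^ r\<close> values.
  For the second, choose \<open>r\<close> independent columns \<open>S\<close> of \<open>A\<close>: given the coordinates of \<open>Z\<close> outside \<open>S\<close>,
  \<open>A Z\<close> determines those in \<open>S\<close>, so \<open>H(A Z)\<close> is at least \<open>r\<close> times the binary entropy of \<open>p\<close>.
  Both estimates, and \<open>C(p) \<ge> 0\<close>, are instances of Gibbs' inequality.
\<close>

section \<open>Gibbs' inequality\<close>

text \<open>Termwise \<open>ln t \<le> t - 1\<close>, rescaled to base 2. Positivity of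
  \<open>g\<close> is asked only where the weight is positive, which admits laws with zero masses
  such as \<open>p = 0\<close>.\<close>

lemma sum_mult_log_nonpos:
  fixes w g :: "'a \<Rightarrow> real"
  assumes w: "\<And>i. i \<in> I \<Longrightarrow> 0 \<le> w i"
    and g: "\<And>i. i \<in> I \<Longrightarrow> 0 < w i \<Longrightarrow> 0 < g i"
    and le: "(\<Sum>i\<in>I. w i * g i) \<le> (\<Sum>i\<in>I. w i)"
  shows "(\<Sum>i\<in>I. w i * log 2 (g i)) \<le> 0"
proof -
  have "(\<Sum>i\<in>I. w i * log 2 (g i)) * ln 2 = (\<Sum>i\<in>I. w i * ln (g i))"
    by (simp add: sum_distrib_right log_def)
  also have "\<dots> \<le> (\<Sum>i\<in>I. w i * (g i - 1))"
  proof (rule sum_mono)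
    fix i assume i: "i \<in> I"
    show "w i * ln (g i) \<le> w i * (g i - 1)"
    proof (cases "w i = 0")
      case False
      then have "0 < w i" using w[OF i] by simp
      then show ?thesis using g[OF i] ln_le_minus_one[of "g i"] by simp
    qed simp
  qed
  also have "\<dots> \<le> 0"
    using le by (simp add: right_diff_distrib sum_subtractf)
  finally show ?thesis
    by (simp add: mult_le_0_iff)
qed

text \<open>Gibbs' inequality for the Bernoulli law against the uniform law on two points: the
  binary entropy is at most one bit.\<close>

lemma bsc_capacity_nonneg:
  assumes "0 \<le> p" "p \<le> 1"
  shows "0 \<le> bsc_capacity p"
proof -
  define w where "w c = (if c then p else 1 - p)" for c
  have "(\<Sum>c\<in>UNIV. w c * log 2 (1 / (2 * w c))) \<le> 0"
    using assms by (intro sum_mult_log_nonpos) (auto simp: UNIV_bool w_def split: if_splits)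
  moreover have "w c * log 2 (1 / (2 * w c)) = - w c * log 2 (w c) - w c" for c
  proof (cases "w c = 0")
    case False
    then have "0 < w c" using assms by (auto simp: w_def split: if_splits)
    then have "log 2 (1 / (2 * w c)) = - log 2 (w c) - 1"
      by (simp add: log_divide log_mult)
    then show ?thesis by (simp only:) (simp add: algebra_simps)
  qed simp
  ultimately have "(\<Sum>c\<in>UNIV. - w c * log 2 (w c) - w c) \<le> 0"
    by simp
  then show ?thesis
    by (simp add: UNIV_bool w_def bsc_capacity_def binary_entropy_def)
qed

section \<open>Coordinate subspaces and sums of products\<close>

text \<open>Restrictions to \<open>S\<close> are encoded as full vectors extended by zero, so that
  recombining the coordinates inside and outside \<open>S\<close> is vector addition.\<close>

definition supported_on :: "'n set \<Rightarrow> ('a::zero ^ 'n) set" where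
  "supported_on S = {z. \<forall>i. i \<notin> S \<longrightarrow> z $ i = 0}"

text \<open>Distributivity over the functions in \<open>PiE S\<close>, which correspond to vectors
  by extension with zero.\<close>

lemma sum_prod_supported_on:
  fixes g :: "'n::finite \<Rightarrow> 'a::{zero,finite} \<Rightarrow> 'b::comm_semiring_1"
  shows "(\<Sum>z\<in>supported_on S. \<Prod>i\<in>S. g i (z $ i)) = (\<Prod>i\<in>S. \<Sum>a\<in>UNIV. g i a)"
proof -
  have "(\<Prod>i\<in>S. \<Sum>a\<in>UNIV. g i a) = (\<Sum>h\<in>PiE S (\<lambda>_. UNIV). \<Prod>i\<in>S. g i (h i))"
    by (rule prod_sum_PiE) auto
  also have "\<dots> = (\<Sum>z\<in>supported_on S. \<Prod>i\<in>S. g i (z $ i))"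
    by (rule sum.reindex_bij_witness[where
          j = "\<lambda>h. \<chi> i. if i \<in> S then h i else 0" and i = "\<lambda>z. restrict (($) z) S"])
       (auto simp: supported_on_def vec_eq_iff PiE_iff extensional_def fun_eq_iff)
  finally show ?thesis by simp
qed

lemma sum_prod_vec:
  fixes g :: "'n::finite \<Rightarrow> 'a::{zero,finite} \<Rightarrow> 'b::comm_semiring_1"
  shows "(\<Sum>z\<in>UNIV. \<Prod>i\<in>UNIV. g i (z $ i)) = (\<Prod>i\<in>UNIV. \<Sum>a\<in>UNIV. g i a)"
  using sum_prod_supported_on[where S = UNIV and g = g] by (simp add: supported_on_def)

lemma sum_supported_on_decompose:
  fixes F :: "'a::{ab_group_add,finite} ^ 'n::finite \<Rightarrow> 'b::comm_monoid_add"
  shows "(\<Sum>z\<in>UNIV. F z) = (\<Sum>t\<in>supported_on (- S). \<Sum>s\<in>supported_on S. F (s + t))"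
proof -
  have "(\<Sum>t\<in>supported_on (- S). \<Sum>s\<in>supported_on S. F (s + t))
      = (\<Sum>(t, s)\<in>supported_on (- S) \<times> supported_on S. F (s + t))"
    by (rule sum.cartesian_product)
  also have "\<dots> = (\<Sum>z\<in>UNIV. F z)"
    by (rule sum.reindex_bij_witness[where j = "\<lambda>(t, s). s + t" and
          i = "\<lambda>z. (\<chi> i. if i \<in> S then 0 else z $ i, \<chi> i. if i \<in> S then z $ i else 0)"])
       (auto simp: supported_on_def vec_eq_iff)
  finally show ?thesis by simp
qed

section \<open>Entropy of additive images of a product law\<close>

text \<open>Additivity of entropy over independent coordinates, up to sign. The logarithm of the
  product splits when all factors are nonzero; otherwise the weight of \<open>z\<close>
  vanishes.\<close>

lemma sum_product_mult_log_product:
  fixes q :: "'a::{zero,finite} \<Rightarrow> real" and S :: "'n::finite set"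
  assumes q: "\<And>a. 0 \<le> q a" and q1: "(\<Sum>a\<in>UNIV. q a) = 1"
  shows "(\<Sum>z\<in>UNIV. (\<Prod>i\<in>UNIV. q (z $ i)) * log 2 (\<Prod>i\<in>S. q (z $ i)))
       = real (card S) * (\<Sum>a\<in>UNIV. q a * log 2 (q a))"
proof -
  have marginal: "(\<Sum>z\<in>UNIV. (\<Prod>j\<in>UNIV. q (z $ j)) * log 2 (q (z $ i))) = (\<Sum>a\<in>UNIV. q a * log 2 (q a))"
    for i :: 'n
  proof -
    \<comment> \<open>Absorbing the logarithm into factor \<open>i\<close> keeps the summand a
      product over coordinates; every other factor then sums to 1.\<close>
    define g where "g j a = (if j = i then q a * log 2 (q a) else q a)" for j a
    have "(\<Prod>j\<in>UNIV. q (z $ j)) * log 2 (q (z $ i)) = (\<Prod>j\<in>UNIV. g j (z $ j))" for z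
      by (subst (1 2) prod.remove[of UNIV i]) (auto simp: g_def)
    then have "(\<Sum>z\<in>UNIV. (\<Prod>j\<in>UNIV. q (z $ j)) * log 2 (q (z $ i))) = (\<Prod>j\<in>UNIV. \<Sum>a\<in>UNIV. g j a)"
      by (simp add: sum_prod_vec)
    also have "\<dots> = (\<Sum>a\<in>UNIV. q a * log 2 (q a))"
      by (subst prod.remove[of UNIV i]) (auto simp: g_def q1)
    finally show ?thesis .
  qed
  have "(\<Prod>i\<in>UNIV. q (z $ i)) * log 2 (\<Prod>i\<in>S. q (z $ i))
      = (\<Sum>i\<in>S. (\<Prod>i\<in>UNIV. q (z $ i)) * log 2 (q (z $ i)))" for z :: "'a ^ 'n"
  proof (cases "\<exists>i. q (z $ i) = 0")
    case True
    then have "(\<Prod>i\<in>UNIV. q (z $ i)) = 0" by simp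
    then show ?thesis by (simp only: mult_zero_left sum.neutral_const)
  next
    case False
    then have "log 2 (\<Prod>i\<in>S. q (z $ i)) = (\<Sum>i\<in>S. log 2 (q (z $ i)))"
      by (simp add: log_def ln_prod sum_divide_distrib less_le q)
    then show ?thesis by (simp add: sum_distrib_left)
  qed
  then show ?thesis
    by (simp add: sum.swap[of _ S] marginal)
qed

text \<open>This bounds the entropy of \<open>h Z\<close> below by that of the coordinates in
  \<open>S\<close>. Gibbs' inequality is applied to the ratio of \<open>Q (h z)\<close> to the mass
  \<open>m S z\<close> of those coordinates. Cancelling \<open>m S z\<close> leaves
  \<open>m (- S) z * Q (h z)\<close>; with the outside coordinates fixed, \<open>h\<close> is
  injective, so the values of \<open>Q\<close> sum to at most 1.\<close>

lemma sum_log_fiber_weight_le: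
  fixes q :: "'a::{ab_group_add,finite} \<Rightarrow> real" and S :: "'n::finite set"
    and h :: "'a ^ 'n \<Rightarrow> 'b::{finite,ab_group_add}"
  assumes q: "\<And>a. 0 \<le> q a" and q1: "(\<Sum>a\<in>UNIV. q a) = 1"
    and h: "\<And>s t. h (s + t) = h s + h t" and inj: "inj_on h (supported_on S)"
  defines "\<mu> \<equiv> \<lambda>z. \<Prod>i\<in>UNIV. q (z $ i)"
  shows "(\<Sum>z\<in>UNIV. \<mu> z * log 2 (\<Sum>y | h y = h z. \<mu> y))
       \<le> real (card S) * (\<Sum>a\<in>UNIV. q a * log 2 (q a))"
proof -
  define Q where "Q v = (\<Sum>y | h y = v. \<mu> y)" for v
  define m where "m T z = (\<Prod>i\<in>T. q (z $ i))" for T and z :: "'a ^ 'n"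
  have \<mu>_nn: "0 \<le> \<mu> z" for z by (simp add: \<mu>_def prod_nonneg q)
  have m_nn: "0 \<le> m T z" for T z by (simp add: m_def prod_nonneg q)
  have \<mu>1: "(\<Sum>z\<in>UNIV. \<mu> z) = 1" by (simp add: \<mu>_def sum_prod_vec[of "\<lambda>_. q"] q1)
  have Q_nn: "0 \<le> Q v" for v by (simp add: Q_def sum_nonneg \<mu>_nn)
  have \<mu>_Q: "\<mu> z \<le> Q (h z)" for z
    unfolding Q_def by (rule member_le_sum) (auto simp: \<mu>_nn)
  have Q1: "(\<Sum>v\<in>UNIV. Q v) = 1"
    unfolding Q_def using sum.group[of UNIV UNIV h \<mu>] \<mu>1 by simp
  have split: "\<mu> z = m S z * m (- S) z" for z
    unfolding \<mu>_def m_def by (subst prod.union_disjoint[symmetric]) (auto simp: Un_commute)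
  have pos: "0 < m S z" if "0 < \<mu> z" for z
    using that split[of z] m_nn[of S z] by (cases "m S z = 0") auto
  \<comment> \<open>Only an inequality: where \<open>m S z = 0\<close> the left term is 0, while the
    right one may be positive.\<close>
  have "(\<Sum>z\<in>UNIV. \<mu> z * (Q (h z) / m S z)) \<le> (\<Sum>z\<in>UNIV. m (- S) z * Q (h z))"
    by (rule sum_mono) (auto simp: split m_nn Q_nn)
  also have "\<dots> = (\<Sum>t\<in>supported_on (- S). m (- S) t * (\<Sum>s\<in>supported_on S. Q (h (s + t))))"
    unfolding sum_supported_on_decompose[of _ S] sum_distrib_left
    by (intro sum.cong refl) (auto simp: m_def supported_on_def intro!: prod.cong)
  also have "\<dots> \<le> (\<Sum>t\<in>supported_on (- S). m (- S) t * 1)"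
  proof (intro sum_mono mult_left_mono m_nn)
    fix t
    have "inj_on (\<lambda>s. h (s + t)) (supported_on S)"
      using inj by (simp add: inj_on_def h)
    then have "(\<Sum>s\<in>supported_on S. Q (h (s + t))) = (\<Sum>v\<in>(\<lambda>s. h (s + t)) ` supported_on S. Q v)"
      by (simp add: sum.reindex)
    also have "\<dots> \<le> 1"
      unfolding Q1[symmetric] by (rule sum_mono2) (auto simp: Q_nn)
    finally show "(\<Sum>s\<in>supported_on S. Q (h (s + t))) \<le> 1" .
  qed
  also have "\<dots> = 1"
    by (simp add: m_def sum_prod_supported_on[where S = "- S" and g = "\<lambda>_. q"] q1)
  finally have "(\<Sum>z\<in>UNIV. \<mu> z * log 2 (Q (h z) / m S z)) \<le> 0"
    using \<mu>_Q pos
    by (intro sum_mult_log_nonpos) (auto simp: \<mu>1 \<mu>_nn intro!: divide_pos_pos intro: less_le_trans)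
  moreover have "\<mu> z * log 2 (Q (h z) / m S z) = \<mu> z * log 2 (Q (h z)) - \<mu> z * log 2 (m S z)" for z
  proof (cases "\<mu> z = 0")
    case False
    then have "0 < \<mu> z" using \<mu>_nn[of z] by simp
    then have "log 2 (Q (h z) / m S z) = log 2 (Q (h z)) - log 2 (m S z)"
      using \<mu>_Q[of z] pos[of z] by (intro log_divide_pos) auto
    then show ?thesis by (simp add: right_diff_distrib)
  qed simp
  moreover have "(\<Sum>z\<in>UNIV. \<mu> z * log 2 (m S z)) = real (card S) * (\<Sum>a\<in>UNIV. q a * log 2 (q a))"
    unfolding \<mu>_def m_def by (rule sum_product_mult_log_product[OF q q1])
  ultimately show ?thesis by (simp add: sum_subtractf Q_def)
qed

section \<open>Column rank and bases of columns\<close>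

text \<open>The library defines the rank as the dimension of the row space and proves its equality with
  the dimension of the column space only for real matrices.\<close>

lemma dim_columns_le_rank:
  fixes A :: "'a::field ^ 'n ^ 'm"
  shows "vec.dim (columns A) \<le> rank A"
proof -
  obtain B where B: "B \<subseteq> rows A" "vec.independent B" "rows A \<subseteq> vec.span B" "card B = vec.dim (rows A)"
    by (rule vec.basis_exists)
  have fin: "finite B" using B(2) by (rule vec.finiteI_independent)
  have "\<forall>i. \<exists>u. row i A = (\<Sum>v\<in>B. u v *s v)"
  proof
    fix i
    have "row i A \<in> vec.span B" using B(3) by (auto simp: rows_def)
    then show "\<exists>u. row i A = (\<Sum>v\<in>B. u v *s v)"
      unfolding vec.span_finite[OF fin] by auto
  qed
  then obtain u where u: "\<And>i. row i A = (\<Sum>v\<in>B. u i v *s v)" by metis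
  \<comment> \<open>The \<open>c v\<close> are the columns of the coefficient matrix that expresses
    the rows of \<open>A\<close> in the basis \<open>B\<close>; read by columns, the same
    factorization puts every column of \<open>A\<close> in their span.\<close>
  define c where "c v = (\<chi> i. u i v)" for v
  have "column j A = (\<Sum>v\<in>B. v $ j *s c v)" for j
  proof -
    have "A $ i $ j = (\<Sum>v\<in>B. u i v * v $ j)" for i
      using arg_cong[OF u[of i], of "\<lambda>x. x $ j"] by (simp add: row_def)
    then show ?thesis
      by (simp add: vec_eq_iff column_def c_def mult.commute)
  qed
  then have "columns A \<subseteq> vec.span (c ` B)"
    by (simp only: columns_def)
       (auto intro!: vec.span_sum vec.span_scale intro: vec.span_base)
  then have "vec.dim (columns A) \<le> card (c ` B)"
    by (rule vec.dim_le_card) (simp add: fin)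
  also have "\<dots> \<le> rank A"
    using card_image_le[OF fin, of c] by (simp add: B(4) row_rank_def_gen)
  finally show ?thesis .
qed

lemma rank_eq_dim_columns:
  fixes A :: "'a::field ^ 'n ^ 'm"
  shows "rank A = vec.dim (columns A)"
  using dim_columns_le_rank[of A] dim_columns_le_rank[of "transpose A"]
  by (simp add: row_rank_def_gen)

lemma mult_supported_on:
  fixes A :: "'a::field ^ 'n ^ 'm"
  assumes "z \<in> supported_on S"
  shows "A *v z = (\<Sum>j\<in>S. z $ j *s column j A)"
  using assms unfolding matrix_mult_sum
  by (intro sum.mono_neutral_right) (auto simp: supported_on_def)

text \<open>\<open>S\<close> indexes a basis of the column space. Independence gives injectivity,
  needed for the entropy of \<open>A Z\<close>; spanning gives the range, needed to count the values
  of \<open>f\<close>.\<close>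

lemma obtain_column_basis:
  fixes A :: "'a::field ^ 'n ^ 'm"
  obtains S where "card S = rank A" "inj_on ((*v) A) (supported_on S)"
    "range ((*v) A) = (*v) A ` supported_on S"
proof -
  obtain B where B: "B \<subseteq> columns A" "vec.independent B" "columns A \<subseteq> vec.span B"
    "card B = vec.dim (columns A)"
    by (rule vec.basis_exists)
  have "B \<subseteq> range (\<lambda>j. column j A)" using B(1) by (auto simp: columns_def)
  \<comment> \<open>Different indices may carry equal columns, so one index is chosen for each basis
    vector.\<close>
  then obtain S where S: "inj_on (\<lambda>j. column j A) S" "B = (\<lambda>j. column j A) ` S"
    by (meson subset_image_inj)
  have "card S = rank A"
    using S B(4) by (simp add: rank_eq_dim_columns card_image)
  moreover have "inj_on ((*v) A) (supported_on S)"
  proof (rule inj_onI)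
    fix x y assume xy: "x \<in> supported_on S" "y \<in> supported_on S" "A *v x = A *v y"
    define z where "z = x - y"
    have z: "z \<in> supported_on S" using xy by (auto simp: z_def supported_on_def)
    have "A *v z = 0" using xy by (simp add: z_def matrix_vector_mult_diff_distrib)
    then have "0 = (\<Sum>j\<in>S. z $ j *s column j A)" by (simp add: mult_supported_on[OF z])
    also have "\<dots> = (\<Sum>v\<in>B. z $ the_inv_into S (\<lambda>j. column j A) v *s v)"
      unfolding S(2) by (subst sum.reindex[OF S(1)]) (simp add: the_inv_into_f_f[OF S(1)])
    finally have "z $ the_inv_into S (\<lambda>j. column j A) v = 0" if "v \<in> B" for v
      using vec.independentD[OF B(2) _ order_refl] that S(2) by simp
    then have "z $ j = 0" if "j \<in> S" for j
      using that S by (force simp: the_inv_into_f_f[OF S(1)])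
    then have "z = 0" using z by (auto simp: supported_on_def vec_eq_iff)
    then show "x = y" by (simp add: z_def)
  qed
  moreover have "range ((*v) A) \<subseteq> (*v) A ` supported_on S"
  proof safe
    fix x
    have "A *v x \<in> vec.span (columns A)"
      unfolding matrix_mult_sum
      by (intro vec.span_sum vec.span_scale vec.span_base) (auto simp: columns_def)
    also have "\<dots> \<subseteq> vec.span B" using B(3) by (simp add: vec.span_minimal)
    finally obtain u where "A *v x = (\<Sum>v\<in>B. u v *s v)"
      using S(2) by (auto simp: vec.span_finite)
    also have "\<dots> = (\<Sum>j\<in>S. u (column j A) *s column j A)"
      unfolding S(2) by (subst sum.reindex[OF S(1)]) simp
    also have "\<dots> = A *v (\<chi> j. if j \<in> S then u (column j A) else 0)"
      by (subst mult_supported_on[of _ S]) (auto simp: supported_on_def)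
    finally show "A *v x \<in> (*v) A ` supported_on S"
      by (auto simp: supported_on_def)
  qed
  ultimately show thesis by (intro that) auto
qed

section \<open>Mutual information of finite random variables\<close>

lemma (in prob_space) distributed_finite:
  fixes X :: "'a \<Rightarrow> 'b::finite"
  assumes [measurable]: "random_variable (count_space UNIV) X"
  shows "distributed M (count_space UNIV) X (\<lambda>x. ennreal (prob (X -` {x} \<inter> space M)))"
  unfolding distributed_def
proof (intro conjI measure_eqI_finite)
  fix x :: 'b
  show "emeasure (distr M (count_space UNIV) X) {x}
      = emeasure (density (count_space UNIV) (\<lambda>x. ennreal (prob (X -` {x} \<inter> space M)))) {x}"
    by (simp add: emeasure_distr emeasure_density emeasure_eq_measure nn_integral_count_space_finite
        indicator_def if_distrib cong: if_cong)
qed auto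

lemma (in prob_space) prob_function_of_finite:
  fixes W :: "'a \<Rightarrow> 'c::finite"
  assumes [measurable]: "random_variable (count_space UNIV) W"
    and U: "\<And>\<omega>. \<omega> \<in> space M \<Longrightarrow> U \<omega> = u (W \<omega>)"
  shows "prob (U -` {a} \<inter> space M) = (\<Sum>w | u w = a. prob (W -` {w} \<inter> space M))"
proof -
  have "U -` {a} \<inter> space M = (\<Union>w\<in>{w. u w = a}. W -` {w} \<inter> space M)"
    using U by auto
  also have "prob \<dots> = (\<Sum>w | u w = a. prob (W -` {w} \<inter> space M))"
    by (rule finite_measure_finite_Union) (auto simp: disjoint_family_on_def)
  finally show ?thesis .
qed

text \<open>Pulling the sum over value pairs back to the common source \<open>W\<close> turns the
  mutual information into a finite expectation under the law of \<open>W\<close>.\<close>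

lemma (in prob_space) mutual_information_functions_of_finite:
  fixes W :: "'a \<Rightarrow> 'c::finite" and u :: "'c \<Rightarrow> 'd::finite" and v :: "'c \<Rightarrow> 'e::finite"
  assumes W: "random_variable (count_space UNIV) W"
    and U: "\<And>\<omega>. \<omega> \<in> space M \<Longrightarrow> U \<omega> = u (W \<omega>)"
    and V: "\<And>\<omega>. \<omega> \<in> space M \<Longrightarrow> V \<omega> = v (W \<omega>)"
    and P: "\<And>w. prob (W -` {w} \<inter> space M) = P w"
  shows "mutual_information 2 (count_space UNIV) (count_space UNIV) U V
    = (\<Sum>w\<in>UNIV. P w * log 2 ((\<Sum>w' | u w' = u w \<and> v w' = v w. P w')
        / ((\<Sum>w' | u w' = u w. P w') * (\<Sum>w' | v w' = v w. P w'))))"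
proof -
  interpret information_space M 2 by standard simp
  have rv: "random_variable (count_space UNIV) T"
    if "\<And>\<omega>. \<omega> \<in> space M \<Longrightarrow> T \<omega> = t (W \<omega>)" for t and T :: "'a \<Rightarrow> 'x"
    using measurable_compose[OF W measurable_count_space[of t]] that
    by (subst measurable_cong) auto
  define J where "J x = (\<Sum>w | (u w, v w) = x. P w)" for x
  let ?PU = "\<lambda>a. \<Sum>w | u w = a. P w" and ?PV = "\<lambda>c. \<Sum>w | v w = c. P w"
  have dU: "distributed M (count_space UNIV) U (\<lambda>a. ennreal (?PU a))"
    using distributed_finite[OF rv[of U, OF U]] by (simp add: prob_function_of_finite[of W U u, OF W U] P)
  have dV: "distributed M (count_space UNIV) V (\<lambda>a. ennreal (?PV a))"
    using distributed_finite[OF rv[of V, OF V]] by (simp add: prob_function_of_finite[of W V v, OF W V] P)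
  have UV: "\<And>\<omega>. \<omega> \<in> space M \<Longrightarrow> (U \<omega>, V \<omega>) = (\<lambda>w. (u w, v w)) (W \<omega>)"
    by (simp add: U V)
  have pair: "count_space (UNIV :: 'd set) \<Otimes>\<^sub>M count_space (UNIV :: 'e set) = count_space UNIV"
    by (simp add: pair_measure_count_space)
  have "distributed M (count_space UNIV) (\<lambda>\<omega>. (U \<omega>, V \<omega>))
      (\<lambda>x. ennreal (prob ((\<lambda>\<omega>. (U \<omega>, V \<omega>)) -` {x} \<inter> space M)))"
    by (rule distributed_finite[OF rv[of "\<lambda>\<omega>. (U \<omega>, V \<omega>)", OF UV]])
  then have dUV: "distributed M (count_space UNIV \<Otimes>\<^sub>M count_space UNIV) (\<lambda>\<omega>. (U \<omega>, V \<omega>)) (\<lambda>x. ennreal (J x))"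
    by (simp only: prob_function_of_finite[of W "\<lambda>\<omega>. (U \<omega>, V \<omega>)" "\<lambda>w. (u w, v w)", OF W UV] P J_def pair)
  have P_nn: "0 \<le> P w" for w by (simp flip: P)
  have "mutual_information 2 (count_space UNIV) (count_space UNIV) U V
      = (\<integral>x. J x * log 2 (J x / (?PU (fst x) * ?PV (snd x))) \<partial>(count_space UNIV \<Otimes>\<^sub>M count_space UNIV))"
    by (rule mutual_information_distr[OF _ _ dU _ dV _ dUV])
       (auto simp: sigma_finite_measure_count_space_finite J_def intro!: sum_nonneg P_nn)
  also have "\<dots> = (\<Sum>x\<in>UNIV. J x * log 2 (J x / (?PU (fst x) * ?PV (snd x))))"
    by (simp add: pair lebesgue_integral_count_space_finite)
  \<comment> \<open>The log ratio is constant on each fiber of the pair map, so it moves inside the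
    sum that defines \<open>J\<close>; the fibers then partition all values of
    \<open>W\<close>.\<close>
  also have "\<dots> = (\<Sum>x\<in>UNIV. \<Sum>w | (u w, v w) = x. P w * log 2 (J (u w, v w) / (?PU (u w) * ?PV (v w))))"
    unfolding J_def sum_distrib_right by (intro sum.cong refl) auto
  also have "\<dots> = (\<Sum>w\<in>UNIV. P w * log 2 (J (u w, v w) / (?PU (u w) * ?PV (v w))))"
    using sum.group[of UNIV UNIV "\<lambda>w. (u w, v w)"
        "\<lambda>w. P w * log 2 (J (u w, v w) / (?PU (u w) * ?PV (v w)))"] by simp
  finally show ?thesis by (simp add: J_def)
qed

section \<open>Counting and the entropy of a function of a uniform variable\<close>

lemma card_supported_on:
  "card (supported_on S :: ('a::{zero,finite} ^ 'n::finite) set) = CARD('a) ^ card S"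
  using sum_prod_supported_on[where S = S and g = "\<lambda>(_::'n) (_::'a). 1 :: nat"] by simp

text \<open>Each nonempty fiber contributes exactly 1.\<close>

lemma sum_inverse_fiber_card:
  fixes f :: "'c::finite \<Rightarrow> 'd"
  shows "(\<Sum>x\<in>UNIV. 1 / real (card {y. f y = f x})) = real (card (range f))"
proof -
  have "(\<Sum>x\<in>UNIV. 1 / real (card {y. f y = f x}))
      = (\<Sum>v\<in>range f. \<Sum>x | f x = v. 1 / real (card {y. f y = f x}))"
    using sum.group[of UNIV "range f" f "\<lambda>x. 1 / real (card {y. f y = f x})"] by simp
  also have "\<dots> = (\<Sum>v\<in>range f. 1)"
    by (intro sum.cong refl) (auto simp: card_eq_0_iff)
  finally show ?thesis by simp
qed

text \<open>For uniform \<open>x\<close>, the value \<open>f x\<close> has probability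
  \<open>card {y. f y = f x} / N\<close>, so this says that its entropy is at most \<open>r\<close>
  bits. Gibbs' inequality compares that probability with \<open>1 / 2 ^ r\<close>.\<close>

lemma sum_log_fiber_card_le:
  fixes f :: "'c::finite \<Rightarrow> 'd"
  assumes "card (range f) \<le> 2 ^ r"
  defines "N \<equiv> real CARD('c)"
  shows "(\<Sum>x\<in>UNIV. 1 / N * log 2 (real (card {y. f y = f x}) / N)) \<ge> - real r"
proof -
  let ?c = "\<lambda>x. real (card {y. f y = f x})"
  have N: "0 < N" by (simp add: N_def)
  have c: "0 < ?c x" for x by (auto simp: card_gt_0_iff)
  have "(\<Sum>x\<in>UNIV. 1 / N * (N / (2 ^ r * ?c x))) = (\<Sum>x\<in>UNIV. 1 / ?c x) / 2 ^ r"
    using N by (simp add: sum_divide_distrib mult.commute)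
  also have "\<dots> \<le> 1"
    unfolding sum_inverse_fiber_card using of_nat_mono[OF assms(1), where 'a = real] by simp
  finally have "(\<Sum>x\<in>UNIV. 1 / N * log 2 (N / (2 ^ r * ?c x))) \<le> 0"
    using N c by (intro sum_mult_log_nonpos) (auto simp: N_def)
  moreover have "log 2 (N / (2 ^ r * ?c x)) = - log 2 (?c x / N) - real r" for x
    using N c[of x] by (simp add: log_divide_pos log_mult_pos log_nat_power)
  ultimately have "(\<Sum>x\<in>UNIV. 1 / N * (- log 2 (?c x / N) - real r)) \<le> 0" by simp
  also have "(\<Sum>x\<in>UNIV. 1 / N * (- log 2 (?c x / N) - real r))
      = - (\<Sum>x\<in>UNIV. 1 / N * log 2 (?c x / N)) - (\<Sum>x\<in>(UNIV::'c set). 1 / N * real r)"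
    by (simp add: right_diff_distrib sum_subtractf sum_negf)
  also have "(\<Sum>x\<in>(UNIV::'c set). 1 / N * real r) = real r"
    by (simp add: N_def)
  finally show ?thesis by simp
qed

section \<open>Affine functions of the input of a binary symmetric channel\<close>

theorem proposition11:
  fixes M :: "'w measure"
    and X Y Z :: "'w \<Rightarrow> bit ^ 'n"
    and f :: "bit ^ 'n \<Rightarrow> bit ^ 'k"
    and A :: "bit ^ 'n ^ 'k"
    and b :: "bit ^ 'k"
    and p :: real
    and r :: nat
  assumes "CARD('n) \<ge> CARD('k)"
    and "0 \<le> p" and "p \<le> 1 / 2"
    and "prob_space M"
    and X_uniform: "distr M (count_space UNIV) X = uniform_count_measure UNIV"
    and Z_indep: "prob_space.indep_vars M (\<lambda>_. count_space UNIV) (\<lambda>i \<omega>. Z \<omega> $ i) UNIV"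
    and Z_bernoulli: "\<And>i. distr M (count_space UNIV) (\<lambda>\<omega>. Z \<omega> $ i)
                         = measure_pmf (map_pmf of_bool (bernoulli_pmf p))"
    and X_Z_indep: "prob_space.indep_var M (count_space UNIV) X (count_space UNIV) Z"
    and Y_eq: "\<And>\<omega>. \<omega> \<in> space M \<Longrightarrow> Y \<omega> = X \<omega> + Z \<omega>"
    and f_affine: "\<And>x. f x = A *v x + b"
    and "rank A = r"
  shows "prob_space.mutual_information M 2 (count_space UNIV) (count_space UNIV) (\<lambda>\<omega>. f (X \<omega>)) Y
           \<le> real r * bsc_capacity p
       \<and> real r * bsc_capacity p \<le> real CARD('k) * bsc_capacity p"
proof
  interpret prob_space M by fact
  \<comment> \<open>The columns lie in a space of dimension \<open>CARD('k)\<close>.\<close>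
  have r_le: "r \<le> CARD('k)"
    using vec.dim_subset_UNIV[of "columns A"] \<open>rank A = r\<close>
    by (simp add: rank_eq_dim_columns vec.dimension_def card_cart_basis)
  then show "real r * bsc_capacity p \<le> real CARD('k) * bsc_capacity p"
    using bsc_capacity_nonneg[of p] assms(2,3) by (intro mult_right_mono) auto

  define q where "q = pmf (map_pmf of_bool (bernoulli_pmf p) :: bit pmf)"
  have q0: "0 \<le> q a" for a by (simp add: q_def)
  have q1: "(\<Sum>a\<in>UNIV. q a) = 1" unfolding q_def by (rule sum_pmf_eq_1) auto
  have UNIV_bit: "(UNIV :: bit set) = {0, 1}" by (auto intro: bit.exhaust)
  have "q (of_bool c) = pmf (bernoulli_pmf p) c" for c
    unfolding q_def by (rule pmf_map_inj') (auto simp: inj_def of_bool_eq_iff)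
  from this[of True] this[of False] have q: "q 1 = p" "q 0 = 1 - p"
    using assms(2,3) by auto
  have entropy_q: "(\<Sum>a\<in>UNIV. q a * log 2 (q a)) = bsc_capacity p - 1"
    by (simp add: UNIV_bit q bsc_capacity_def binary_entropy_def)

  define N where "N = real CARD(bit ^ 'n)"
  define \<mu> where "\<mu> z = (\<Prod>i\<in>UNIV. q (z $ i))" for z :: "bit ^ 'n"
  have N: "0 < N" by (simp add: N_def)
  have \<mu>_nn: "0 \<le> \<mu> z" for z by (simp add: \<mu>_def prod_nonneg q0)
  have \<mu>1: "(\<Sum>z\<in>UNIV. \<mu> z) = 1"
    using sum_prod_vec[of "\<lambda>_::'n. q"] by (simp add: \<mu>_def q1)

  have X[measurable]: "random_variable (count_space UNIV) X"
    and Z[measurable]: "random_variable (count_space UNIV) Z"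
    using indep_var_rv1[OF X_Z_indep] indep_var_rv2[OF X_Z_indep] .
  have PX: "prob (X -` {x} \<inter> space M) = 1 / N" for x
    using measure_distr[OF X, of "{x}"]
    by (simp add: X_uniform measure_uniform_count_measure N_def)
  have PZ: "prob (Z -` {z} \<inter> space M) = \<mu> z" for z
  proof -
    have "prob ((\<lambda>\<omega>. Z \<omega> $ i) -` {z $ i} \<inter> space M) = q (z $ i)" for i
    proof -
      have "(\<lambda>\<omega>. Z \<omega> $ i) \<in> M \<rightarrow>\<^sub>M count_space UNIV"
        using Z_indep by (auto simp: indep_vars_def)
      from measure_distr[OF this, of "{z $ i}"] show ?thesis
        by (simp add: Z_bernoulli q_def measure_pmf_single)
    qed
    moreover have "Z -` {z} \<inter> space M = (\<Inter>i\<in>UNIV. (\<lambda>\<omega>. Z \<omega> $ i) -` {z $ i} \<inter> space M)"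
      by (auto simp: vec_eq_iff)
    ultimately show ?thesis
      using indep_varsD_finite[OF Z_indep, of "\<lambda>i. {z $ i}"] by (simp add: \<mu>_def)
  qed
  \<comment> \<open>Both \<open>f X\<close> and \<open>Y\<close> are functions of this pair, whose
    law is explicit by independence.\<close>
  define W where "W = (\<lambda>\<omega>. (X \<omega>, Z \<omega>))"
  have "random_variable (count_space UNIV \<Otimes>\<^sub>M count_space UNIV) W"
    unfolding W_def by measurable
  then have W: "random_variable (count_space UNIV) W"
    by (simp add: pair_measure_count_space)
  have PW: "prob (W -` {w} \<inter> space M) = \<mu> (snd w) / N" for w
    using indep_varD[OF X_Z_indep, of "{fst w}" "{snd w}"]
    by (simp add: W_def PX PZ)

  define Q where "Q v = (\<Sum>z | A *v z = v. \<mu> z)" for v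
  define c where "c x = real (card {x'. f x' = f x})" for x
  have \<mu>_Q: "\<mu> z \<le> Q (A *v z)" for z
    unfolding Q_def by (rule member_le_sum) (auto simp: \<mu>_nn)
  have c: "0 < c x" for x by (auto simp: c_def card_gt_0_iff)
  have mf: "(\<Sum>w' | f (fst w') = f x. \<mu> (snd w') / N) = c x / N" for x
  proof -
    have "(\<Sum>w' | f (fst w') = f x. \<mu> (snd w') / N) = (\<Sum>(x', z)\<in>{x'. f x' = f x} \<times> UNIV. \<mu> z / N)"
      by (rule sum.cong) auto
    also have "\<dots> = c x / N"
      by (simp add: sum.cartesian_product[symmetric] \<mu>1 c_def flip: sum_divide_distrib)
    finally show ?thesis .
  qed
  \<comment> \<open>Each noise vector \<open>z\<close> reaches \<open>y\<close> from exactly one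
    input, \<open>y - z\<close>, so \<open>Y\<close> is uniform whatever the law of the
    noise.\<close>
  have mY: "(\<Sum>w' | fst w' + snd w' = y. \<mu> (snd w') / N) = 1 / N" for y
  proof -
    have "(\<Sum>w' | fst w' + snd w' = y. \<mu> (snd w') / N) = (\<Sum>z\<in>UNIV. \<mu> z / N)"
      by (rule sum.reindex_bij_witness[where j = snd and i = "\<lambda>z. (y - z, z)"]) auto
    then show ?thesis by (simp add: \<mu>1 flip: sum_divide_distrib)
  qed
  \<comment> \<open>Pairs with output \<open>x + z\<close> are parametrized by their noise
    \<open>z'\<close>; equality of the \<open>f\<close> values becomes
    \<open>A *v z' = A *v z\<close>, since \<open>b\<close> cancels.\<close>
  have mfY: "(\<Sum>w' | f (fst w') = f x \<and> fst w' + snd w' = x + z. \<mu> (snd w') / N) = Q (A *v z) / N" for x z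
  proof -
    have A_iff: "f (x + z - z') = f x \<longleftrightarrow> A *v z' = A *v z" for z'
      by (auto simp: f_affine matrix_vector_mult_diff_distrib matrix_vector_right_distrib)
    have fiber: "f x' = f x \<and> x' + z' = x + z \<longleftrightarrow> x' = x + z - z' \<and> A *v z' = A *v z" for x' z'
      using A_iff[of z'] by (metis add_diff_cancel_right' diff_add_cancel)
    have "(\<Sum>w' | f (fst w') = f x \<and> fst w' + snd w' = x + z. \<mu> (snd w') / N)
        = (\<Sum>z' | A *v z' = A *v z. \<mu> z' / N)"
      unfolding fiber
      by (rule sum.reindex_bij_witness[where j = snd and i = "\<lambda>z'. (x + z - z', z')"]) auto
    then show ?thesis by (simp add: Q_def flip: sum_divide_distrib)
  qed

  obtain S where S: "card S = rank A" "inj_on ((*v) A) (supported_on S)"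
    "range ((*v) A) = (*v) A ` supported_on S"
    by (rule obtain_column_basis)
  \<comment> \<open>The shift \<open>b\<close> only translates the range, and the range of
    \<open>A\<close> is already the image of a set of \<open>2 ^ r\<close> vectors.\<close>
  have "card (range f) = card ((\<lambda>v. v + b) ` range ((*v) A))"
    by (simp add: image_image f_affine[abs_def])
  also have "\<dots> \<le> card (supported_on S :: (bit ^ 'n) set)"
    unfolding S(3) image_image by (rule card_image_le) simp
  also have "\<dots> = 2 ^ r"
    using S(1) \<open>rank A = r\<close> by (simp add: card_supported_on UNIV_bit numeral_2_eq_2)
  finally have log_c: "(\<Sum>x\<in>UNIV. 1 / N * log 2 (c x / N)) \<ge> - real r"
    unfolding N_def c_def by (rule sum_log_fiber_card_le)

  have log_Q: "(\<Sum>z\<in>UNIV. \<mu> z * log 2 (Q (A *v z))) \<le> real r * (bsc_capacity p - 1)"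
    using sum_log_fiber_weight_le[OF q0 q1 matrix_vector_right_distrib S(2)]
    by (simp add: \<mu>_def Q_def entropy_q S(1) \<open>rank A = r\<close>)

  \<comment> \<open>The factor \<open>1 / N\<close> of the joint law cancels against the uniform law
    of \<open>Y\<close>. The case \<open>\<mu> z = 0\<close> is separate because
    \<open>Q (A *v z)\<close> may vanish there.\<close>
  have split: "\<mu> z / N * log 2 (Q (A *v z) / N / (c x / N * (1 / N)))
      = 1 / N * (\<mu> z * log 2 (Q (A *v z))) - \<mu> z * (1 / N * log 2 (c x / N))" for x z
  proof (cases "\<mu> z = 0")
    case False
    then have "0 < Q (A *v z)" using \<mu>_Q[of z] \<mu>_nn[of z] by simp
    then have "log 2 (Q (A *v z) / (c x / N)) = log 2 (Q (A *v z)) - log 2 (c x / N)"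
      using c[of x] N by (intro log_divide_pos) auto
    moreover have "Q (A *v z) / N / (c x / N * (1 / N)) = Q (A *v z) / (c x / N)"
      using N by simp
    ultimately show ?thesis by (simp only:) (simp add: right_diff_distrib diff_divide_distrib)
  qed simp
  have "mutual_information 2 (count_space UNIV) (count_space UNIV) (\<lambda>\<omega>. f (X \<omega>)) Y
      = (\<Sum>w\<in>UNIV. \<mu> (snd w) / N * log 2 (Q (A *v snd w) / N / (c (fst w) / N * (1 / N))))"
    by (subst mutual_information_functions_of_finite[OF W, where u = "\<lambda>w. f (fst w)"
          and v = "\<lambda>w. fst w + snd w", OF _ _ PW])
       (simp_all add: W_def Y_eq mf mY mfY)
  also have "\<dots> = (\<Sum>x\<in>UNIV. \<Sum>z\<in>UNIV. 1 / N * (\<mu> z * log 2 (Q (A *v z))) - \<mu> z * (1 / N * log 2 (c x / N)))"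
    by (simp only: split) (simp add: sum.cartesian_product case_prod_unfold flip: UNIV_Times_UNIV)
  \<comment> \<open>The first term does not depend on \<open>x\<close>, so its \<open>N\<close>
    copies cancel \<open>1 / N\<close>; in the second the masses \<open>\<mu> z\<close> sum to
    1.\<close>
  also have "\<dots> = (\<Sum>z\<in>UNIV. \<mu> z * log 2 (Q (A *v z))) - (\<Sum>x\<in>UNIV. 1 / N * log 2 (c x / N))"
    by (simp only: sum_subtractf flip: sum_distrib_left sum_distrib_right)
       (simp add: \<mu>1 N_def)
  also have "\<dots> \<le> real r * bsc_capacity p"
    using log_Q log_c by (simp add: algebra_simps)
  finally show "mutual_information 2 (count_space UNIV) (count_space UNIV) (\<lambda>\<omega>. f (X \<omega>)) Y
      \<le> real r * bsc_capacity p" .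
qed

end
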